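(* Let $P\subseteq\mathbb{R}^n$ be an $(n-1)$-dimensional extended generalized permutohedron, with $f$-polynomial $f(P,q)$ and weighted quasisymmetric enumerator $F_q(P)$. Then the $f$-polynomial of $P$ is determined by the principal specialization $$f(P,q)=(-1)^{n-1}\,\mathbf{ps}^1\big(F_{-q}(P)\big)(-1).$$
   Context: Quasisymmetric functions. For a composition $\alpha=(\alpha_1,\ldots,\alpha_k)$ of a positive integer (an ordered list of positive integers) with $k(\alpha)=k$ parts, the monomial quasisymmetric function in the ordered variables $x_1<x_2<\cdots$ is $M_\alpha=\sum_{i_1<\cdots<i_k}x_{i_1}^{\alpha_1}\cdots x_{i_k}^{\alpha_k}$. For a quasisymmetric function $F$ (a linear combination of the $M_\alpha$) the principal specialization is $\mathbf{ps}^1(F)(m)=F(1,\ldots,1,0,0,\ldots)$ ($m$ ones). One has $\mathbf{ps}^1(M_\alpha)(m)=\binom{m}{k(\alpha)}$, a polynomial in $m$, and evaluation at $m=-1$ means evaluating this polynomial, so $\mathbf{ps}^1(M_\alpha)(-1)=\binom{-1}{k(\alpha)}=(-1)^{k(\alpha)}$; it is extended linearly over coefficients that are polynomials in the indeterminate $q$. Braid fan. A flag on $[n]=\{1,\ldots,n\}$ is a chain $\mathcal{F}:\emptyset=F_0\subset F_1\subset\cdots\subset F_k=[n]$ of strictly increasing subsets. Its braid cone $C_\mathcal{F}\subseteq\mathbb{R}^n$ is the set of $x$ with $x_p=x_q$ whenever $p,q$ lie in the same block $F_i\setminus F_{i-1}$ and $x_p\le x_q$ whenever $p\in F_i\setminus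 F_{i-1}$ and $q\in F_{i+1}\setminus F_i$. The cones $C_\mathcal{F}$, over all flags $\mathcal{F}$ on $[n]$, form the braid arrangement fan in $\mathbb{R}^n$. Extended generalized permutohedra. For a polyhedron $P\subseteq\mathbb{R}^n$ and a nonempty face $G$ of $P$ (including $P$ itself), the normal cone $C_G$ is the set of $\omega\in\mathbb{R}^n$ such that the function $x\mapsto\langle\omega,x\rangle$ on $P$ attains its maximum at every point of $G$; its relative interior $C_G^\circ$ consists of those $\omega$ for which the set of maximizers on $P$ is exactly $G$. The normal fan $\mathcal{N}(P)$ is the collection of all the cones $C_G$. An extended generalized permutohedron is a polyhedron $P\subseteq\mathbb{R}^n$ whose normal fan is a coarsening of a subfan of the braid arrangement fan (every cone of $\mathcal{N}(P)$ is a union of cones of that subfan). Enumerator. With $L(P)$ the set of nonempty faces of $P$ and $\mathbb{Z}^n_+$ the set of vectors of positive integers, $$F_q(P)=\sum_{G\in L(P)}q^{\dim G}\sum_{\omega\in\mathbb{Z}^n_+\cap C_G^\circ}x_{\omega_1}x_{\omega_2}\cdots x_{\omega_n},$$ which is a quasisymmetric function with coefficients in $\mathbb{Z}[q]$. $F_{-q}(P)$ is obtained by replacing $q$ by $-q$. The $f$-polynomial is $f(P,q)=f_0+f_1q+\cdots+f_{n-1}q^{n-1}$, where $f_i$ is the number of $i$-dimensional faces of $P$.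
   Formalization: The sign (-1)^{n-1} is replaced by (-1)^n: with the stated conventions the printed sign fails, e.g. for a point in R^1, where f = 1, F_q = M_(1) and ps^1(F_{-q})(-1) = -1, so the printed right-hand side is -1. *)

theory Defs
  imports
    "HOL-Analysis.Analysis"
    "HOL-Library.Multiset"
    "HOL-Computational_Algebra.Polynomial"
begin

text \<open>The ground set [n] is the finite index type 'n, with n = CARD('n).\<close>

definition flag :: "'n::finite set list \<Rightarrow> bool" where
  "flag Fs \<longleftrightarrow>
     Fs \<noteq> [] \<and> hd Fs = {} \<and> last Fs = UNIV \<and> sorted_wrt (\<subset>) Fs"

definition braid_cone :: "'n::finite set list \<Rightarrow> (real ^ 'n) set" where
  "braid_cone Fs =
     {x. (\<forall>i p q. Suc i < length Fs \<and> p \<in> Fs ! Suc i - Fs ! i \<and> q \<in> Fs ! Suc i - Fs ! i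
            \<longrightarrow> x $ p = x $ q) \<and>
         (\<forall>i p q. Suc (Suc i) < length Fs \<and> p \<in> Fs ! Suc i - Fs ! i
              \<and> q \<in> Fs ! Suc (Suc i) - Fs ! Suc i
            \<longrightarrow> x $ p \<le> x $ q)}"

definition braid_fan :: "(real ^ 'n::finite) set set" where
  "braid_fan = {braid_cone Fs | Fs. flag Fs}"

definition nonempty_faces :: "(real ^ 'n::finite) set \<Rightarrow> (real ^ 'n) set set" where
  "nonempty_faces P = {G. G face_of P \<and> G \<noteq> {}}"

definition normal_cone :: "(real ^ 'n::finite) set \<Rightarrow> (real ^ 'n) set \<Rightarrow> (real ^ 'n) set" where
  "normal_cone P G = {w. \<forall>x\<in>G. \<forall>y\<in>P. w \<bullet> y \<le> w \<bullet> x}"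

definition normal_fan :: "(real ^ 'n::finite) set \<Rightarrow> (real ^ 'n) set set" where
  "normal_fan P = normal_cone P ` nonempty_faces P"

text \<open>
  A subcollection of a fan is itself a fan as soon as it is closed under taking nonempty faces:
  the condition on pairwise intersections is inherited.
\<close>

definition subfan :: "(real ^ 'n::finite) set set \<Rightarrow> (real ^ 'n) set set \<Rightarrow> bool" where
  "subfan S N \<longleftrightarrow> S \<subseteq> N \<and> (\<forall>C\<in>S. nonempty_faces C \<subseteq> S)"

definition coarsening :: "(real ^ 'n::finite) set set \<Rightarrow> (real ^ 'n) set set \<Rightarrow> bool" where
  "coarsening N S \<longleftrightarrow> (\<forall>C\<in>N. \<exists>T\<subseteq>S. C = \<Union>T)"

definition extended_generalized_permutohedron :: "(real ^ 'n::finite) set \<Rightarrow> bool" where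
  "extended_generalized_permutohedron P \<longleftrightarrow>
     polyhedron P \<and> (\<exists>S. subfan S braid_fan \<and> coarsening (normal_fan P) S)"

definition f_number :: "(real ^ 'n::finite) set \<Rightarrow> nat \<Rightarrow> nat" where
  "f_number P i = card {G \<in> nonempty_faces P. aff_dim G = int i}"

definition f_polynomial :: "(real ^ 'n::finite) set \<Rightarrow> int poly" where
  "f_polynomial P = (\<Sum>i<CARD('n). monom (int (f_number P i)) i)"

text \<open>
  A formal series of bounded degree in the variables \<open>x\<^sub>1, x\<^sub>2, \<dots>\<close> is the function giving the
  coefficient of each monomial; a monomial is the multiset of the indices of its variables.
  The coefficients are polynomials in q.
\<close>

type_synonym q_series = "nat multiset \<Rightarrow> int poly"

definition enumerator :: "(real ^ 'n::finite) set \<Rightarrow> q_series" where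
  "enumerator P m =
     (\<Sum>G\<in>nonempty_faces P. monom 1 (nat (aff_dim G)) *
        of_nat (card {w :: 'n \<Rightarrow> nat. (\<forall>i. 1 \<le> w i) \<and>
          (\<chi> i. real (w i)) \<in> rel_interior (normal_cone P G) \<and>
          image_mset w (mset_set UNIV) = m}))"

definition negate_q :: "q_series \<Rightarrow> q_series" where
  "negate_q F m = pcompose (F m) [:0, -1:]"

text \<open>
  The value F(1,...,1,0,0,...) with m ones: the monomials not killed are those in
  \<open>x\<^sub>1, \<dots>, x\<^sub>m\<close> only, and there are finitely many of them in F when F has bounded degree.
\<close>

definition ps1 :: "q_series \<Rightarrow> nat \<Rightarrow> int poly" where
  "ps1 F m = (\<Sum>M | F M \<noteq> 0 \<and> set_mset M \<subseteq> {1..m}. F M)"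

text \<open>
  For quasisymmetric F, \<open>ps1 F\<close> is a polynomial in m, with coefficients in \<open>\<rat>[q]\<close> since the
  monomial quasisymmetric functions specialize to binomial coefficients in m. Such a
  polynomial is unique, its values at all natural numbers being prescribed.
\<close>

definition ps1_poly :: "q_series \<Rightarrow> rat poly poly" where
  "ps1_poly F = (THE p. \<forall>m. poly p (of_nat m) = map_poly of_int (ps1 F m))"

text \<open>
  With these conventions the sign relating \<open>f_polynomial P\<close> and
  \<open>poly (ps1_poly (negate_q (enumerator P))) (-1)\<close> is \<open>(-1) ^ n\<close>, not \<open>(-1) ^ (n - 1)\<close>;
  for a point P in dimension n = 1 the f-polynomial is 1, the enumerator is
  \<open>x\<^sub>1 + x\<^sub>2 + \<dots>\<close>, and its specialization m takes the value -1 at m = -1.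
\<close>

end

theory Submission
  imports Defs
begin

text \<open>
  For a face \<open>G\<close>, the relative interior \<open>U\<close> of the normal cone is convex, relatively open, of
  dimension \<open>n - dim G\<close>, and a union of open braid cones. The number of its points in
  \<open>{1..m}\<^sup>n\<close> is the sum of \<open>m choose k\<close> over these open cones, \<open>k\<close> being the dimension, hence its
  value at -1 is the Euler characteristic of \<open>U\<close> with compact support, \<open>(-1) ^ dim U\<close>. This sign
  cancels the one coming from \<open>q \<mapsto> -q\<close>, and each face contributes exactly \<open>q ^ dim G\<close>.
\<close>

subsection \<open>Counting integer points with a given order pattern\<close>

text \<open>For real vectors this says that both lie in the same relatively open braid cone. The two
  codomains may differ, so that a real vector can be compared with a word of positive
  integers.\<close>

definition order_equiv :: "('a \<Rightarrow> 'b::linorder) \<Rightarrow> ('a \<Rightarrow> 'c::linorder) \<Rightarrow> bool" where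
  "order_equiv f g \<longleftrightarrow> (\<forall>i j. f i \<le> f j \<longleftrightarrow> g i \<le> g j)"

lemma order_equiv_refl: "order_equiv f f"
  by (simp add: order_equiv_def)

lemma order_equiv_sym: "order_equiv f g \<Longrightarrow> order_equiv g f"
  by (simp add: order_equiv_def)

lemma order_equiv_trans: "order_equiv f g \<Longrightarrow> order_equiv g h \<Longrightarrow> order_equiv f h"
  by (simp add: order_equiv_def)

lemma order_equiv_less:
  assumes "order_equiv f g"
  shows "f i < f j \<longleftrightarrow> g i < g j"
proof -
  have "f j \<le> f i \<longleftrightarrow> g j \<le> g i"
    using assms unfolding order_equiv_def by blast
  then show ?thesis
    by (simp only: not_le[symmetric])
qed

lemma order_equiv_eq:
  assumes "order_equiv f g"
  shows "f i = f j \<longleftrightarrow> g i = g j"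
proof -
  have "f i \<le> f j \<longleftrightarrow> g i \<le> g j" "f j \<le> f i \<longleftrightarrow> g j \<le> g i"
    using assms unfolding order_equiv_def by blast+
  then show ?thesis
    by (metis order_antisym order_refl)
qed

lemma order_equivI:
  assumes less: "\<And>i j. f i < f j \<Longrightarrow> g i < g j" and eq: "\<And>i j. f i = f j \<Longrightarrow> g i = g j"
  shows "order_equiv f g"
  unfolding order_equiv_def
proof (intro allI iffI)
  fix i j
  show "g i \<le> g j" if "f i \<le> f j"
    using less[of i j] eq[of i j] that by (metis order_le_less)
  show "f i \<le> f j" if "g i \<le> g j"
    using less[of j i] that by (metis leD leI)
qed

lemma card_image_cong_kernel:
  assumes "\<And>i j. i \<in> A \<Longrightarrow> j \<in> A \<Longrightarrow> f i = f j \<longleftrightarrow> g i = g j"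
  shows "card (f ` A) = card (g ` A)"
proof (rule bij_betw_same_card)
  show "bij_betw (\<lambda>y. g (inv_into A f y)) (f ` A) (g ` A)"
    unfolding bij_betw_def inj_on_def
  proof (intro conjI ballI impI)
    fix x y assume xy: "x \<in> f ` A" "y \<in> f ` A" "g (inv_into A f x) = g (inv_into A f y)"
    then show "x = y"
      by (metis assms f_inv_into_f inv_into_into)
  next
    show "(\<lambda>y. g (inv_into A f y)) ` f ` A = g ` A"
    proof safe
      fix i assume "i \<in> A"
      then show "g (inv_into A f (f i)) \<in> g ` A"
        by (simp add: inv_into_into)
      have "g i = g (inv_into A f (f i))"
        using assms \<open>i \<in> A\<close> by (metis f_inv_into_f imageI inv_into_into)
      then show "g i \<in> (\<lambda>y. g (inv_into A f y)) ` f ` A"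
        using \<open>i \<in> A\<close> by blast
    qed
  qed
qed

lemma rank_less:
  fixes a b :: "'a::linorder"
  assumes "finite V" "a \<in> V" "a < b"
  shows "card {v \<in> V. v < a} < card {v \<in> V. v < b}"
  using assms by (intro psubset_card_mono) auto

text \<open>A value is determined by its rank in the common range, that is, by the number of values
  below it. An order equivalence preserves these numbers.\<close>

lemma order_equiv_range_unique:
  fixes f g :: "'a::finite \<Rightarrow> 'b::linorder"
  assumes "order_equiv f g" "range f = range g"
  shows "f = g"
proof
  fix i
  have "card (f ` {j. f j < f i}) = card (g ` {j. f j < f i})"
    by (rule card_image_cong_kernel) (use order_equiv_eq[OF assms(1)] in blast)
  moreover have "f ` {j. f j < f i} = {v \<in> range f. v < f i}"
    by auto
  moreover have "g ` {j. f j < f i} = {v \<in> range f. v < g i}"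
    using assms(2) by (auto simp: order_equiv_less[OF assms(1)])
  ultimately have eq: "card {v \<in> range f. v < f i} = card {v \<in> range f. v < g i}"
    by simp
  have "f i \<in> range f" "g i \<in> range f"
    using assms(2) by auto
  then show "f i = g i"
    using eq rank_less[of "range f" "f i" "g i"] rank_less[of "range f" "g i" "f i"]
    by (cases "f i" "g i" rule: linorder_cases) auto
qed

text \<open>Replacing each value of \<open>f\<close> by its rank gives a pattern onto an initial
  segment of the naturals; the increasing enumeration of \<open>K\<close> then carries it onto
  \<open>K\<close>.\<close>

lemma order_equiv_with_range:
  fixes f :: "'a::finite \<Rightarrow> 'b::linorder" and K :: "nat set"
  assumes "finite K" "card K = card (range f)"
  obtains g where "order_equiv f g" "range g = K"
proof -
  define r where "r i = card {v \<in> range f. v < f i}" for i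
  have r_less: "r i < r j" if "f i < f j" for i j
    unfolding r_def using that by (intro rank_less) auto
  have r: "order_equiv f r"
    by (rule order_equivI) (use r_less in \<open>auto simp: r_def\<close>)
  have "r i < card (range f)" for i
    unfolding r_def by (intro psubset_card_mono) auto
  then have "range r \<subseteq> {..<card K}"
    using assms(2) by auto
  moreover have "card (range r) = card K"
    using card_image_cong_kernel[of UNIV r f] order_equiv_eq[OF r] assms(2) by simp
  ultimately have range_r: "range r = {..<card K}"
    by (simp add: card_subset_eq)
  obtain h where h: "bij_betw h {..<card K} K" "strict_mono_on {..<card K} h"
    using ex_bij_betw_strict_mono_card[OF assms(1)] by blast
  have "r i < card K" for i
    using range_r by auto
  then have "order_equiv r (h \<circ> r)"
    using h(2) by (intro order_equivI) (simp_all add: strict_mono_on_def)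
  then have "order_equiv f (h \<circ> r)"
    by (rule order_equiv_trans[OF r])
  moreover have "range (h \<circ> r) = K"
    unfolding image_comp[symmetric] range_r using h(1) by (rule bij_betw_imp_surj_on)
  ultimately show ?thesis
    by (rule that)
qed

text \<open>A word with a prescribed order pattern amounts to the choice of its set of values, any
  subset of {1..m} of the right size. This is the specialization of a monomial quasisymmetric
  function at m ones.\<close>

lemma card_order_equiv_box:
  fixes f :: "'a::finite \<Rightarrow> 'b::linorder"
  shows "card {w. range w \<subseteq> {1..m} \<and> order_equiv f w} = m choose card (range f)"
proof -
  have "bij_betw range {w. range w \<subseteq> {1..m} \<and> order_equiv f w}
      {K. K \<subseteq> {1..m} \<and> card K = card (range f)}"
    unfolding bij_betw_def
  proof
    show "inj_on range {w. range w \<subseteq> {1..m} \<and> order_equiv f w}"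
    proof (rule inj_onI)
      fix v w assume "v \<in> {w. range w \<subseteq> {1..m} \<and> order_equiv f w}"
        "w \<in> {w. range w \<subseteq> {1..m} \<and> order_equiv f w}" and eq: "range v = range w"
      then have "order_equiv f v" "order_equiv f w"
        by simp_all
      then have "order_equiv v w"
        by (rule order_equiv_trans[OF order_equiv_sym])
      then show "v = w"
        using eq by (rule order_equiv_range_unique)
    qed
    show "range ` {w. range w \<subseteq> {1..m} \<and> order_equiv f w} =
        {K. K \<subseteq> {1..m} \<and> card K = card (range f)}"
    proof (intro subset_antisym subsetI)
      fix K assume "K \<in> range ` {w. range w \<subseteq> {1..m} \<and> order_equiv f w}"
      then obtain w where w: "K = range w" "range w \<subseteq> {1..m}" "order_equiv f w"
        by blast
      then have "card K = card (range f)"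
        using card_image_cong_kernel[of UNIV w f] order_equiv_eq[OF w(3)] by simp
      with w show "K \<in> {K. K \<subseteq> {1..m} \<and> card K = card (range f)}"
        by blast
    next
      fix K assume "K \<in> {K. K \<subseteq> {1..m} \<and> card K = card (range f)}"
      then have K: "K \<subseteq> {1..m}" "card K = card (range f)"
        by auto
      then obtain w where "order_equiv f w" "range w = K"
        using order_equiv_with_range[of K f] finite_subset by blast
      with K show "K \<in> range ` {w. range w \<subseteq> {1..m} \<and> order_equiv f w}"
        by blast
    qed
  qed
  then show ?thesis
    using n_subsets[of "{1..m}" "card (range f)"] by (simp add: bij_betw_same_card[of range])
qed

lemma binomial_poly:
  obtains p :: "rat poly"
  where "\<And>m. poly p (of_nat m) = of_nat (m choose k)" "poly p (- 1) = (- 1) ^ k"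
proof
  \<comment> \<open>The falling factorial of degree \<open>k\<close>, divided by
    \<open>k!\<close>.\<close>
  define p :: "rat poly" where "p = smult (1 / fact k) (\<Prod>i<k. [:- of_nat i, 1:])"
  have p: "poly p a = a gchoose k" for a
    by (simp add: p_def poly_prod gbinomial_prod_rev atLeast0LessThan)
  show "poly p (of_nat m) = of_nat (m choose k)" for m
    by (simp add: p binomial_gbinomial)
  show "poly p (- 1) = (- 1) ^ k"
    \<comment> \<open>Negating the upper index turns -1 choose k into the sign times k choose k,
      which is 1.\<close>
    using gbinomial_minus[of "1::rat" k] by (simp add: p flip: binomial_gbinomial)
qed

subsection \<open>Reciprocity for braid-invariant convex sets\<close>

text \<open>Such a set is a union of relatively open braid cones.\<close>

definition order_invariant :: "(real ^ 'n::finite) set \<Rightarrow> bool" where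
  "order_invariant U \<longleftrightarrow> (\<forall>x\<in>U. \<forall>y. order_equiv (($) x) (($) y) \<longrightarrow> y \<in> U)"

lemma order_invariantD:
  assumes "order_invariant U" "order_equiv (($) x) (($) y)"
  shows "x \<in> U \<longleftrightarrow> y \<in> U"
proof
  show "y \<in> U" if "x \<in> U"
    by (rule assms(1)[unfolded order_invariant_def, rule_format, OF that assms(2)])
  show "x \<in> U" if "y \<in> U"
    by (rule assms(1)[unfolded order_invariant_def, rule_format, OF that
          order_equiv_sym[OF assms(2)]])
qed

text \<open>Each strict inequality is an open condition and there are finitely many pairs of
  indices, so one small \<open>t\<close> serves all of them.\<close>

lemma eventually_perturbation_less:
  fixes x v :: "real ^ 'n::finite"
  shows "\<forall>\<^sub>F t in at_right 0. \<forall>i j. x $ i < x $ j \<longrightarrow> (x + t *\<^sub>R v) $ i < (x + t *\<^sub>R v) $ j"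
proof (intro eventually_all_finite)
  fix i j
  show "\<forall>\<^sub>F t in at_right 0. x $ i < x $ j \<longrightarrow> (x + t *\<^sub>R v) $ i < (x + t *\<^sub>R v) $ j"
  proof (cases "x $ i < x $ j")
    case True
    have "((\<lambda>t. (x + t *\<^sub>R v) $ j - (x + t *\<^sub>R v) $ i)
        \<longlongrightarrow> (x + 0 *\<^sub>R v) $ j - (x + 0 *\<^sub>R v) $ i) (at_right 0)"
      by (intro tendsto_intros)
    then have "\<forall>\<^sub>F t in at_right 0. 0 < (x + t *\<^sub>R v) $ j - (x + t *\<^sub>R v) $ i"
      using True by (intro order_tendstoD) auto
    then show ?thesis
      by eventually_elim simp
  qed simp
qed

text \<open>A point is in the relative interior exactly when each segment from a point
  \<open>z\<close> of \<open>C\<close> can be prolonged a little beyond it. For \<open>x\<close> and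
  \<open>y\<close> of the same pattern, a short prolongation from the same \<open>z\<close> again
  gives two points of the same pattern, so invariance of \<open>C\<close> carries the criterion from
  \<open>x\<close> to \<open>y\<close>.\<close>

lemma order_invariant_rel_interior:
  fixes C :: "(real ^ 'n::finite) set"
  assumes "convex C" "order_invariant C"
  shows "order_invariant (rel_interior C)"
  unfolding order_invariant_def
proof (intro ballI allI impI)
  fix x y :: "real ^ 'n"
  assume x: "x \<in> rel_interior C" and xy: "order_equiv (($) x) (($) y)"
  then have "x \<in> C"
    using rel_interior_subset by blast
  then have "C \<noteq> {}"
    by blast
  show "y \<in> rel_interior C"
    unfolding convex_rel_interior_iff[OF assms(1) \<open>C \<noteq> {}\<close>]
  proof
    fix z assume "z \<in> C"
    then obtain e where e: "e > 1" "(1 - e) *\<^sub>R z + e *\<^sub>R x \<in> C"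
      using x convex_rel_interior_iff[OF assms(1) \<open>C \<noteq> {}\<close>] by blast
    have "\<forall>\<^sub>F t in at_right (0::real). t \<in> {0<..<e - 1}"
      using e by (intro eventually_at_right_real) simp
    with eventually_perturbation_less[of x "x - z"] eventually_perturbation_less[of y "y - z"]
    have "\<forall>\<^sub>F t in at_right 0. t \<in> {0<..<e - 1} \<and>
        order_equiv (($) (x + t *\<^sub>R (x - z))) (($) (y + t *\<^sub>R (y - z)))"
    proof eventually_elim
      case (elim t)
      have "(x + t *\<^sub>R (x - z)) $ i \<le> (x + t *\<^sub>R (x - z)) $ j \<longleftrightarrow>
          (y + t *\<^sub>R (y - z)) $ i \<le> (y + t *\<^sub>R (y - z)) $ j" for i j
      \<comment> \<open>A tie of \<open>x\<close> is also a tie of \<open>y\<close>, and it is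
        broken in both by the coordinates of \<open>z\<close> alone. A strict inequality survives
        for small \<open>t\<close>.\<close>
      proof (cases "x $ i = x $ j")
        case True
        then have "y $ i = y $ j"
          using order_equiv_eq[OF xy] by blast
        with True elim show ?thesis
          by simp
      next
        case False
        then consider "x $ i < x $ j" "y $ i < y $ j" | "x $ j < x $ i" "y $ j < y $ i"
          using order_equiv_less[OF xy] by (meson linorder_neqE)
        then show ?thesis
          using elim by cases (meson less_imp_le not_le)+
      qed
      then show ?case
        using elim by (simp add: order_equiv_def)
    qed
    then obtain t where t: "t \<in> {0<..<e - 1}"
        "order_equiv (($) (x + t *\<^sub>R (x - z))) (($) (y + t *\<^sub>R (y - z)))"
      using eventually_happens'[OF trivial_limit_at_right_real] by blast
    \<comment> \<open>This places the shorter prolongation on the segment from \<open>x\<close> to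
      the given point of \<open>C\<close>; the bound \<open>t < e - 1\<close> keeps \<open>s\<close>
      below 1.\<close>
    define s where "s = t / (e - 1)"
    have s: "0 \<le> s" "s \<le> 1" "s * (e - 1) = t"
      using t e by (auto simp: s_def)
    have "x + t *\<^sub>R (x - z) = (1 - s) *\<^sub>R x + s *\<^sub>R ((1 - e) *\<^sub>R z + e *\<^sub>R x)"
      unfolding s(3)[symmetric] by (simp add: algebra_simps)
    also have "\<dots> \<in> C"
      using convexD_alt[OF assms(1) \<open>x \<in> C\<close> e(2) s(1,2)] .
    finally have "y + t *\<^sub>R (y - z) \<in> C"
      using order_invariantD[OF assms(2) t(2)] by simp
    then show "\<exists>e>1. (1 - e) *\<^sub>R z + e *\<^sub>R y \<in> C"
      using t(1) by (intro exI[of _ "1 + t"]) (simp add: algebra_simps)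
  qed
qed

lemma order_invariant_Int_less:
  fixes U :: "(real ^ 'n::finite) set"
  assumes "order_invariant U"
  shows "order_invariant (U \<inter> {x. x $ i < x $ j})"
  unfolding order_invariant_def
proof (intro ballI allI impI)
  fix x y :: "real ^ 'n"
  assume x: "x \<in> U \<inter> {x. x $ i < x $ j}" and xy: "order_equiv (($) x) (($) y)"
  show "y \<in> U \<inter> {x. x $ i < x $ j}"
    using order_invariantD[OF assms xy] order_equiv_less[OF xy, of i j] x by simp
qed

lemma order_invariant_Int_eq:
  fixes U :: "(real ^ 'n::finite) set"
  assumes "order_invariant U"
  shows "order_invariant (U \<inter> {x. x $ i = x $ j})"
  unfolding order_invariant_def
proof (intro ballI allI impI)
  fix x y :: "real ^ 'n"
  assume x: "x \<in> U \<inter> {x. x $ i = x $ j}" and xy: "order_equiv (($) x) (($) y)"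
  show "y \<in> U \<inter> {x. x $ i = x $ j}"
    using order_invariantD[OF assms xy] order_equiv_eq[OF xy, of i j] x by simp
qed

text \<open>For \<open>U\<close> the relative interior of a normal cone, these words index the terms
  of the enumerator that survive when the first \<open>m\<close> variables are 1 and the others
  0.\<close>

definition box_points :: "(real ^ 'n::finite) set \<Rightarrow> nat \<Rightarrow> ('n \<Rightarrow> nat) set" where
  "box_points U m = {w. range w \<subseteq> {1..m} \<and> (\<chi> i. real (w i)) \<in> U}"

lemma finite_box_points [simp]: "finite (box_points U m)"
proof (rule finite_subset)
  show "box_points U m \<subseteq> PiE UNIV (\<lambda>_. {1..m})"
    by (auto simp: box_points_def)
qed (simp add: finite_PiE)

section \<open>Dimension of a relatively open braid cone\<close>

lemma open_component_less: "open {x :: real ^ 'n::finite. x $ i < x $ j}"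
  by (intro open_Collect_less continuous_on_component continuous_on_id)

text \<open>The indicator vectors of the fibres of \<open>f\<close> are nonzero and pairwise
  orthogonal, hence independent, and they span the space.\<close>

lemma dim_constant_on_fibers:
  fixes f :: "'n::finite \<Rightarrow> 'b"
  shows "dim {y :: real ^ 'n. \<forall>i j. f i = f j \<longrightarrow> y $ i = y $ j} = card (range f)"
proof -
  define e :: "'b \<Rightarrow> real ^ 'n" where "e v = (\<chi> i. if f i = v then 1 else 0)" for v
  define L where "L = {y :: real ^ 'n. \<forall>i j. f i = f j \<longrightarrow> y $ i = y $ j}"
  have e_f: "e (f i) $ i = 1" for i
    by (simp add: e_def)
  have "pairwise orthogonal (e ` range f)"
  proof (rule pairwiseI)
    fix a b assume "a \<in> e ` range f" "b \<in> e ` range f" "a \<noteq> b"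
    then obtain u v where uv: "a = e u" "b = e v"
      by blast
    with \<open>a \<noteq> b\<close> have "u \<noteq> v"
      by auto
    with uv show "orthogonal a b"
      by (auto simp: orthogonal_def inner_vec_def e_def intro!: sum.neutral)
  qed
  moreover have "0 \<notin> e ` range f"
  proof
    assume "0 \<in> e ` range f"
    then obtain i where "e (f i) = 0"
      by auto
    with e_f[of i] show False
      by simp
  qed
  ultimately have indep: "independent (e ` range f)"
    by (rule pairwise_orthogonal_independent)
  have "inj_on e (range f)"
  proof (rule inj_onI)
    fix u v assume uv: "u \<in> range f" "e u = e v"
    then obtain i where "u = f i"
      by blast
    then have "e v $ i = 1"
      using uv e_f by metis
    then show "u = v"
      using \<open>u = f i\<close> by (simp add: e_def split: if_splits)
  qed
  then have "card (e ` range f) = card (range f)"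
    by (rule card_image)
  moreover have "e ` range f \<subseteq> L"
    by (auto simp: L_def e_def)
  moreover have "L \<subseteq> span (e ` range f)"
  proof
    fix y assume "y \<in> L"
    \<comment> \<open>The coefficient of an indicator is the value of \<open>y\<close> at any chosen
      index of the fibre.\<close>
    have "y = (\<Sum>v\<in>range f. y $ (inv f v) *\<^sub>R e v)"
    proof (rule vec_eq_iff[THEN iffD2], rule allI)
      fix i
      have "(\<Sum>v\<in>range f. y $ (inv f v) *\<^sub>R e v) $ i
          = (\<Sum>v\<in>range f. if f i = v then y $ inv f v else 0)"
        by (simp add: e_def if_distrib cong: if_cong)
      also have "\<dots> = y $ inv f (f i)"
        by simp
      also have "\<dots> = y $ i"
      proof -
        have "f (inv f (f i)) = f i"
          by (simp add: f_inv_into_f)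
        then show ?thesis
          using \<open>y \<in> L\<close> unfolding L_def by blast
      qed
      finally show "y $ i = (\<Sum>v\<in>range f. y $ (inv f v) *\<^sub>R e v) $ i"
        by simp
    qed
    also have "\<dots> \<in> span (e ` range f)"
      by (intro span_sum span_scale span_base) auto
    finally show "y \<in> span (e ` range f)" .
  qed
  ultimately show ?thesis
    using indep basis_card_eq_dim[of "e ` range f" L] unfolding L_def by simp
qed

text \<open>The ties of \<open>x\<close> define a subspace \<open>L\<close>, and the strict
  inequalities of \<open>x\<close> cut out of it a nonempty relatively open set, which has the full
  dimension of \<open>L\<close>.\<close>

lemma aff_dim_order_equiv_class:
  fixes x :: "real ^ 'n::finite"
  shows "aff_dim {y :: real ^ 'n. order_equiv (($) x) (($) y)} = int (card (range (($) x)))"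
proof -
  define L where "L = {y :: real ^ 'n. \<forall>i j. x $ i = x $ j \<longrightarrow> y $ i = y $ j}"
  have "subspace L"
    unfolding L_def
  proof (intro subspaceI CollectI allI impI)
    fix u v :: "real ^ 'n" and i j
    assume "u \<in> {y. \<forall>i j. x $ i = x $ j \<longrightarrow> y $ i = y $ j}"
      "v \<in> {y. \<forall>i j. x $ i = x $ j \<longrightarrow> y $ i = y $ j}" "x $ i = x $ j"
    then have "u $ i = u $ j" "v $ i = v $ j"
      by blast+
    then show "(u + v) $ i = (u + v) $ j"
      by simp
  next
    fix c :: real and u :: "real ^ 'n" and i j
    assume "u \<in> {y. \<forall>i j. x $ i = x $ j \<longrightarrow> y $ i = y $ j}" "x $ i = x $ j"
    then have "u $ i = u $ j"
      by blast
    then show "(c *\<^sub>R u) $ i = (c *\<^sub>R u) $ j"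
      by simp
  qed simp
  have "order_equiv (($) x) (($) y) \<longleftrightarrow>
      y \<in> L \<and> y \<in> (\<Inter>i. \<Inter>j. if x $ i < x $ j then {y. y $ i < y $ j} else UNIV)" for y
  proof
    assume xy: "order_equiv (($) x) (($) y)"
    show "y \<in> L \<and> y \<in> (\<Inter>i. \<Inter>j. if x $ i < x $ j then {y. y $ i < y $ j} else UNIV)"
      unfolding L_def using order_equiv_less[OF xy] order_equiv_eq[OF xy] by auto
  next
    assume y: "y \<in> L \<and> y \<in> (\<Inter>i. \<Inter>j. if x $ i < x $ j then {y. y $ i < y $ j} else UNIV)"
    show "order_equiv (($) x) (($) y)"
    proof (rule order_equivI)
      fix i j
      show "y $ i = y $ j" if "x $ i = x $ j"
        using y that unfolding L_def by blast
      have "y \<in> (if x $ i < x $ j then {y. y $ i < y $ j} else UNIV)"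
        using y by blast
      then show "y $ i < y $ j" if "x $ i < x $ j"
        using that by simp
    qed
  qed
  then have "{y :: real ^ 'n. order_equiv (($) x) (($) y)} =
      L \<inter> (\<Inter>i. \<Inter>j. if x $ i < x $ j then {y. y $ i < y $ j} else UNIV)"
    by blast
  moreover have "open (\<Inter>i. \<Inter>j. if x $ i < x $ j then {y :: real ^ 'n. y $ i < y $ j} else UNIV)"
    by (intro open_INT finite ballI) (simp add: open_component_less)
  ultimately have "openin (top_of_set L) {y :: real ^ 'n. order_equiv (($) x) (($) y)}"
    by (simp only: openin_open_Int)
  moreover have "x \<in> {y :: real ^ 'n. order_equiv (($) x) (($) y)}"
    by (simp add: order_equiv_refl)
  then have "{y :: real ^ 'n. order_equiv (($) x) (($) y)} \<noteq> {}"
    by blast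
  ultimately have "aff_dim {y :: real ^ 'n. order_equiv (($) x) (($) y)} = aff_dim L"
    using \<open>subspace L\<close> by (intro aff_dim_openin subspace_imp_affine)
  also have "\<dots> = int (dim L)"
    using \<open>subspace L\<close> by (rule aff_dim_subspace)
  finally show ?thesis
    unfolding L_def dim_constant_on_fibers .
qed

text \<open>Reciprocity at -1: cutting \<open>U\<close> along a hyperplane \<open>x $ i = x $ j\<close> gives pieces of dimensions
  \<open>d\<close>, \<open>d\<close> and \<open>d - 1\<close>, whose signs add up to \<open>(-1) ^ d\<close>; if no such hyperplane cuts \<open>U\<close>,
  then \<open>U\<close> is a single open braid cone.\<close>

lemma box_points_poly:
  fixes U :: "(real ^ 'n::finite) set"
  assumes "convex U" "rel_open U" "U \<noteq> {}" "order_invariant U"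
  shows "\<exists>p :: rat poly. (\<forall>m. poly p (of_nat m) = of_nat (card (box_points U m))) \<and>
    poly p (- 1) = (- 1) ^ nat (aff_dim U)"
  using assms
proof (induction "card {(i, j). (\<exists>x\<in>U. x $ i = x $ j) \<and> (\<exists>y\<in>U. y $ i \<noteq> y $ j)}"
    arbitrary: U rule: less_induct)
  case less
  let ?cuts = "\<lambda>U :: (real ^ 'n) set. {(i, j). (\<exists>x\<in>U. x $ i = x $ j) \<and> (\<exists>y\<in>U. y $ i \<noteq> y $ j)}"
  show ?case
  proof (cases "?cuts U = {}")
    case True
    obtain x where x: "x \<in> U"
      using less.prems by blast
    have "order_equiv (($) x) (($) y)" if y: "y \<in> U" for y
    proof (rule order_equivI)
      fix i j
      show "y $ i = y $ j" if "x $ i = x $ j"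
        using True x y that by blast
      show "y $ i < y $ j" if lt: "x $ i < x $ j"
      proof (rule ccontr)
        assume "\<not> y $ i < y $ j"
        \<comment> \<open>The parameter at which the segment from \<open>x\<close> to
          \<open>y\<close> meets the hyperplane where coordinates \<open>i\<close> and
          \<open>j\<close> agree. Such a point would make the pair a cut of
          \<open>U\<close>.\<close>
        define t where "t = (x $ j - x $ i) / ((x $ j - x $ i) + (y $ i - y $ j))"
        have t: "0 \<le> t" "t \<le> 1"
          using lt \<open>\<not> y $ i < y $ j\<close> by (auto simp: t_def)
        have "t * ((x $ j - x $ i) + (y $ i - y $ j)) = x $ j - x $ i"
          using lt \<open>\<not> y $ i < y $ j\<close> by (simp add: t_def)
        then have "((1 - t) *\<^sub>R x + t *\<^sub>R y) $ i = ((1 - t) *\<^sub>R x + t *\<^sub>R y) $ j"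
          by (simp add: algebra_simps)
        moreover have "(1 - t) *\<^sub>R x + t *\<^sub>R y \<in> U"
          using t x y by (intro convexD_alt[OF less.prems(1)])
        moreover have "x $ i \<noteq> x $ j"
          using lt by simp
        ultimately show False
          using True x by blast
      qed
    qed
    then have U: "U = {y :: real ^ 'n. order_equiv (($) x) (($) y)}"
      using order_invariantD[OF less.prems(4)] x by blast
    have "card (box_points U m) = m choose card (range (($) x))" for m
    proof -
      have "order_equiv (($) x) (($) (\<chi> i. real (w i))) \<longleftrightarrow> order_equiv (($) x) w" for w
        by (simp add: order_equiv_def)
      then show ?thesis
        unfolding box_points_def U using card_order_equiv_box[of m "($) x"] by simp
    qed
    moreover have "nat (aff_dim U) = card (range (($) x))"
      unfolding U aff_dim_order_equiv_class by simp
    ultimately show ?thesis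
      using binomial_poly by metis
  next
    case False
    then obtain i j x y where ij: "x \<in> U" "x $ i = x $ j" "y \<in> U" "y $ i \<noteq> y $ j"
      by blast
    \<comment> \<open>Since \<open>x\<close> lies on the hyperplane and \<open>U\<close> is
      relatively open, the segment from \<open>y\<close> through \<open>x\<close> can be prolonged
      inside \<open>U\<close> to a point on the other side.\<close>
    have y': "\<exists>z\<in>U. z $ i < z $ j" "\<exists>z\<in>U. z $ j < z $ i"
    proof -
      have "x \<in> rel_interior U"
        using ij less.prems(2) by (simp add: rel_open_def)
      then obtain e where e: "e > 1" "(1 - e) *\<^sub>R y + e *\<^sub>R x \<in> U"
        using ij convex_rel_interior_iff[OF less.prems(1,3)] by blast
      define z where "z = (1 - e) *\<^sub>R y + e *\<^sub>R x"
      have z: "z $ i - z $ j = (1 - e) * (y $ i - y $ j)"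
        using ij(2) by (simp add: z_def algebra_simps)
      have "(y $ i < y $ j \<and> z $ j < z $ i) \<or> (y $ j < y $ i \<and> z $ i < z $ j)"
      proof (cases "y $ i < y $ j")
        case True
        then have "(1 - e) * (y $ i - y $ j) > 0"
          using e by (simp add: zero_less_mult_iff)
        then show ?thesis using z True by linarith
      next
        case False
        then have "(1 - e) * (y $ i - y $ j) < 0"
          using e ij by (simp add: mult_less_0_iff)
        then show ?thesis using z False ij by linarith
      qed
      then show "\<exists>z\<in>U. z $ i < z $ j" "\<exists>z\<in>U. z $ j < z $ i"
        using ij e(2) unfolding z_def by blast+
    qed
    define A B E where "A = U \<inter> {x. x $ i < x $ j}" and "B = U \<inter> {x. x $ j < x $ i}"
      and "E = U \<inter> {x. x $ i = x $ j}"
    have ne: "A \<noteq> {}" "B \<noteq> {}" "E \<noteq> {}"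
      using y' ij by (auto simp: A_def B_def E_def)
    have U_open: "openin (top_of_set (affine hull U)) U"
      using less.prems(2) by (simp add: rel_open)
    have half: "{x :: real ^ 'n. x $ i < x $ j} = {x. (axis i 1 - axis j 1) \<bullet> x < 0}"
      "{x :: real ^ 'n. x $ j < x $ i} = {x. (axis i 1 - axis j 1) \<bullet> x > 0}"
      "{x :: real ^ 'n. x $ i = x $ j} = {x. (axis i 1 - axis j 1) \<bullet> x = 0}"
      by (auto simp: inner_diff_left inner_axis')
    have "convex A" "convex B" "convex E"
      unfolding A_def B_def E_def half
      by (intro convex_Int less.prems(1) convex_halfspace_lt convex_halfspace_gt convex_hyperplane)+
    \<comment> \<open>A nonempty intersection with an open set is still open in the affine hull of
      \<open>U\<close>, so it has the same affine hull and dimension.\<close>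
    have open_cut: "rel_open (U \<inter> S)" "aff_dim (U \<inter> S) = aff_dim U" if "open S" "U \<inter> S \<noteq> {}" for S
    proof -
      have "openin (top_of_set (affine hull U)) (U \<inter> S)"
        using U_open \<open>open S\<close> by (rule openin_Int_open)
      then show "aff_dim (U \<inter> S) = aff_dim U"
        using that(2) aff_dim_openin[of "affine hull U"] by simp
      have "affine hull (U \<inter> S) = affine hull U"
        using \<open>openin (top_of_set (affine hull U)) (U \<inter> S)\<close> that(2)
          affine_hull_openin[of U "U \<inter> S"] by blast
      then show "rel_open (U \<inter> S)"
        using \<open>openin (top_of_set (affine hull U)) (U \<inter> S)\<close> by (simp add: rel_open)
    qed
    have "rel_open A" "aff_dim A = aff_dim U" "rel_open B" "aff_dim B = aff_dim U"
      using open_cut[OF open_component_less[of i j]] open_cut[OF open_component_less[of j i]] ne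
      unfolding A_def B_def by blast+
    have E_open: "openin (top_of_set (affine hull U \<inter> {x. x $ i = x $ j})) E"
      unfolding E_def using openin_subtopology_Int[OF U_open] by (simp add: subtopology_subtopology)
    have E_affine: "affine (affine hull U \<inter> {x. x $ i = x $ j})"
      unfolding half by (intro affine_Int affine_affine_hull affine_hyperplane)
    have "aff_dim E = aff_dim (affine hull U \<inter> {x. x $ i = x $ j})"
      using E_open E_affine ne(3) by (rule aff_dim_openin)
    \<comment> \<open>The point \<open>x\<close> shows that the hyperplane meets the affine hull,
      and \<open>y\<close> that it does not contain it, so the dimension drops by exactly
      one.\<close>
    also have "\<dots> = aff_dim U - 1"
    proof -
      have "affine hull U \<inter> {x. x $ i = x $ j} \<noteq> {}" "\<not> affine hull U \<subseteq> {x. x $ i = x $ j}"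
        using ij hull_subset[of U affine] by auto
      then show ?thesis
        unfolding half
        using aff_dim_affine_Int_hyperplane[OF affine_affine_hull[of U], of "axis i 1 - axis j 1" 0]
        by simp
    qed
    finally have E_dim: "aff_dim E = aff_dim U - 1" .
    have "affine hull E = affine hull U \<inter> {x. x $ i = x $ j}"
      using affine_hull_openin[of "affine hull U \<inter> {x. x $ i = x $ j}" E] E_open E_affine ne(3)
      by (simp add: hull_same)
    then have "rel_open E"
      using E_open by (simp add: rel_open)
    \<comment> \<open>Passing to a subset creates no new cutting pair, and each piece loses the pair
      \<open>(i, j)\<close>.\<close>
    have fewer: "card (?cuts V) < card (?cuts U)" if "V \<subseteq> U" "(i, j) \<notin> ?cuts V" for V
    proof (rule psubset_card_mono)
      show "?cuts V \<subset> ?cuts U"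
        using that ij by blast
    qed simp
    have "A \<subseteq> U" "B \<subseteq> U" "E \<subseteq> U" "(i, j) \<notin> ?cuts A" "(i, j) \<notin> ?cuts B" "(i, j) \<notin> ?cuts E"
      by (auto simp: A_def B_def E_def)
    note fewer = fewer[OF this(1,4)] fewer[OF this(2,5)] fewer[OF this(3,6)]
    have inv: "order_invariant A" "order_invariant B" "order_invariant E"
      unfolding A_def B_def E_def
      by (intro order_invariant_Int_less order_invariant_Int_eq less.prems(4))+
    obtain a :: "rat poly" where a: "\<And>m. poly a (of_nat m) = of_nat (card (box_points A m))"
        "poly a (- 1) = (- 1) ^ nat (aff_dim A)"
      using less.hyps[OF fewer(1) \<open>convex A\<close> \<open>rel_open A\<close> ne(1) inv(1)] by blast
    obtain b :: "rat poly" where b: "\<And>m. poly b (of_nat m) = of_nat (card (box_points B m))"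
        "poly b (- 1) = (- 1) ^ nat (aff_dim B)"
      using less.hyps[OF fewer(2) \<open>convex B\<close> \<open>rel_open B\<close> ne(2) inv(2)] by blast
    obtain e :: "rat poly" where e: "\<And>m. poly e (of_nat m) = of_nat (card (box_points E m))"
        "poly e (- 1) = (- 1) ^ nat (aff_dim E)"
      using less.hyps[OF fewer(3) \<open>convex E\<close> \<open>rel_open E\<close> ne(3) inv(3)] by blast
    have "card (box_points U m) =
        card (box_points A m) + card (box_points B m) + card (box_points E m)" for m
    proof -
      have "x \<in> U \<longleftrightarrow> x \<in> A \<or> x \<in> B \<or> x \<in> E" for x
        unfolding A_def B_def E_def by (cases "x $ i" "x $ j" rule: linorder_cases) auto
      then have "box_points U m = (box_points A m \<union> box_points B m) \<union> box_points E m"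
        unfolding box_points_def by blast
      moreover have "A \<inter> B = {}" "A \<inter> E = {}" "B \<inter> E = {}"
        unfolding A_def B_def E_def by auto
      then have "box_points A m \<inter> box_points B m = {}"
        "(box_points A m \<union> box_points B m) \<inter> box_points E m = {}"
        unfolding box_points_def by blast+
      ultimately show ?thesis
        by (simp add: card_Un_disjoint)
    qed
    moreover have "poly (a + b + e) (- 1) = (- 1) ^ nat (aff_dim U)"
    proof -
      \<comment> \<open>Nonnegativity keeps \<open>nat\<close> from truncating, so the exponents of
        the signs really differ by one.\<close>
      have "aff_dim E \<ge> 0"
        using ne(3) by (metis aff_dim_negative_iff not_le)
      then have "nat (aff_dim U) = Suc (nat (aff_dim E))"
        using E_dim by simp
      then show ?thesis
        using a b e \<open>aff_dim A = aff_dim U\<close> \<open>aff_dim B = aff_dim U\<close> by simp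
    qed
    ultimately show ?thesis
      using a b e by (intro exI[of _ "a + b + e"]) simp
  qed
qed

subsection \<open>Normal cones\<close>

text \<open>Let \<open>L\<close> be the direction space of \<open>G\<close>. Normal vectors are
  constant on \<open>G\<close>, so the cone is orthogonal to \<open>L\<close>, which bounds its
  dimension from above. Conversely, a vector orthogonal to the whole cone is shown to lie in
  \<open>L\<close>, which gives the opposite bound.\<close>

lemma aff_dim_normal_cone:
  fixes P :: "(real ^ 'n::finite) set"
  assumes "polyhedron P" "G \<in> nonempty_faces P"
  shows "aff_dim (normal_cone P G) = int CARD('n) - aff_dim G"
proof -
  define C where "C = normal_cone P G"
  have G: "G face_of P" "G \<noteq> {}" "convex G" "G \<subseteq> P"
    using assms by (auto simp: nonempty_faces_def face_of_imp_convex face_of_imp_subset)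
  then obtain x0 where x0: "x0 \<in> rel_interior G"
    using rel_interior_eq_empty by blast
  then have x0G: "x0 \<in> G"
    using rel_interior_subset by blast
  define L where "L = span ((+) (- x0) ` G)"
  have dimL: "aff_dim G = int (dim L)"
    using aff_dim_eq_dim[of x0 G] x0G by (simp add: L_def hull_inc dim_span)
  have "0 \<in> C"
    by (simp add: C_def normal_cone_def)
  then have dimC: "aff_dim C = int (dim C)"
    by (simp add: aff_dim_zero hull_inc)
  have "C \<subseteq> {y \<in> UNIV. \<forall>x\<in>L. orthogonal x y}"
  proof clarsimp
    fix w x assume w: "w \<in> C" and "x \<in> L"
    have "w \<bullet> y = w \<bullet> x0" if "y \<in> G" for y
    proof (rule antisym)
      show "w \<bullet> y \<le> w \<bullet> x0" "w \<bullet> x0 \<le> w \<bullet> y"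
        using w that x0G \<open>G \<subseteq> P\<close> unfolding C_def normal_cone_def by auto
    qed
    then have "\<And>y. y \<in> (+) (- x0) ` G \<Longrightarrow> orthogonal w y"
      by (auto simp: orthogonal_def inner_simps)
    then show "orthogonal x w"
      using \<open>x \<in> L\<close> unfolding L_def by (metis orthogonal_commute orthogonal_to_span)
  qed
  then have "dim C \<le> dim {y \<in> UNIV. \<forall>x\<in>L. orthogonal x y}"
    by (rule dim_subset)
  moreover have "dim {y \<in> UNIV. \<forall>x\<in>L. orthogonal x y} + dim L = CARD('n)"
    using dim_subspace_orthogonal_to_vectors[of L UNIV] by (simp add: L_def)
  ultimately have upper: "dim C + dim L \<le> CARD('n)"
    by simp
  \<comment> \<open>From a relative interior point \<open>x0\<close> of \<open>G\<close>, small
    moves along \<open>v\<close> and \<open>-v\<close> satisfy every defining inequality of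
    \<open>P\<close>; the face property then puts the moved points into \<open>G\<close>.\<close>
  have "{v \<in> UNIV. \<forall>w\<in>span C. orthogonal w v} \<subseteq> L"
  proof clarsimp
    fix v assume v: "\<forall>w\<in>span C. orthogonal w v"
    obtain F where F: "finite F" "P = \<Inter>F" "\<And>h. h \<in> F \<Longrightarrow> \<exists>a b. a \<noteq> 0 \<and> h = {x. a \<bullet> x \<le> b}"
      using assms(1) unfolding polyhedron_def by blast
    have ev: "\<forall>\<^sub>F t in at_right 0. x0 + t *\<^sub>R u \<in> h"
      if h: "h \<in> F" and u: "u = v \<or> u = - v" for h u
    proof -
      obtain a b where ab: "h = {x. a \<bullet> x \<le> b}"
        using F(3)[OF h] by blast
      have Ph: "a \<bullet> x \<le> b" if "x \<in> P" for x
        using that F(2) h ab by auto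
      show ?thesis
      proof (cases "a \<bullet> x0 = b")
        \<comment> \<open>An inequality tight at \<open>x0\<close> is tight on all of
          \<open>G\<close>: slack at some \<open>x\<close> would produce a violation on prolonging
          the segment from \<open>x\<close> beyond \<open>x0\<close>. Its normal \<open>a\<close>
          thus belongs to the cone and is orthogonal to \<open>v\<close>.\<close>
        case True
        have "a \<bullet> x = b" if x: "x \<in> G" for x
        proof -
          obtain e where e: "e > 1" "(1 - e) *\<^sub>R x + e *\<^sub>R x0 \<in> G"
            using x0 x convex_rel_interior_iff[OF G(3,2)] by blast
          then have "(1 - e) * (a \<bullet> x) + e * b \<le> b"
            using Ph[of "(1 - e) *\<^sub>R x + e *\<^sub>R x0"] G(4) True by (auto simp: inner_simps)
          then have "(e - 1) * (b - a \<bullet> x) \<le> 0"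
            by (simp add: algebra_simps)
          then have "b \<le> a \<bullet> x"
            using e by (simp add: mult_le_0_iff)
          then show ?thesis
            using Ph[of x] x G(4) by force
        qed
        then have "a \<in> C"
          using Ph by (auto simp: C_def normal_cone_def)
        then have "orthogonal a v"
          using v by (simp add: span_base)
        then have "a \<bullet> u = 0"
          using u by (auto simp: orthogonal_def)
        then show ?thesis
          using True by (simp add: ab inner_simps)
      next
        \<comment> \<open>A strict inequality persists for small \<open>t\<close> by
          continuity.\<close>
        case False
        then have "a \<bullet> x0 < b"
          using Ph[of x0] x0G G(4) by force
        moreover have "((\<lambda>t. a \<bullet> (x0 + t *\<^sub>R u)) \<longlongrightarrow> a \<bullet> (x0 + 0 *\<^sub>R u)) (at_right 0)"
          by (intro tendsto_intros)
        ultimately have "\<forall>\<^sub>F t in at_right 0. a \<bullet> (x0 + t *\<^sub>R u) < b"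
          by (intro order_tendstoD) auto
        then show ?thesis
          by eventually_elim (simp add: ab)
      qed
    qed
    have "\<forall>\<^sub>F t in at_right (0::real). \<forall>h\<in>F. x0 + t *\<^sub>R v \<in> h"
      "\<forall>\<^sub>F t in at_right (0::real). \<forall>h\<in>F. x0 + t *\<^sub>R (- v) \<in> h"
      by (rule eventually_ball_finite[OF F(1)], use ev in blast)+
    moreover have "\<forall>\<^sub>F t in at_right (0::real). t > 0"
      by (simp add: eventually_at_right_less)
    ultimately have "\<forall>\<^sub>F t in at_right (0::real). t > 0 \<and> x0 + t *\<^sub>R v \<in> P \<and> x0 - t *\<^sub>R v \<in> P"
      by eventually_elim (use F(2) in auto)
    then obtain t where t: "t > 0" "x0 + t *\<^sub>R v \<in> P" "x0 - t *\<^sub>R v \<in> P"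
      using eventually_happens'[OF trivial_limit_at_right_real] by blast
    show "v \<in> L"
    proof (cases "v = 0")
      case True
      then show ?thesis by (simp add: L_def span_zero)
    next
      case False
      have "x0 = midpoint (x0 + t *\<^sub>R v) (x0 - t *\<^sub>R v)"
        by (simp add: midpoint_def algebra_simps flip: scaleR_2)
      moreover have "x0 + t *\<^sub>R v \<noteq> x0 - t *\<^sub>R v"
      proof
        assume "x0 + t *\<^sub>R v = x0 - t *\<^sub>R v"
        then have "(2 * t) *\<^sub>R v = 0"
          by (simp add: algebra_simps flip: scaleR_2)
        then show False
          using t False by simp
      qed
      ultimately have "x0 \<in> open_segment (x0 + t *\<^sub>R v) (x0 - t *\<^sub>R v)"
        by (metis midpoint_in_open_segment)
      then have "x0 + t *\<^sub>R v \<in> G"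
        using face_ofD[OF G(1)] t x0G by blast
      then have "t *\<^sub>R v \<in> L"
        unfolding L_def by (intro span_base) (auto simp: image_iff intro!: bexI[of _ "x0 + t *\<^sub>R v"])
      then have "(1 / t) *\<^sub>R (t *\<^sub>R v) \<in> L"
        unfolding L_def by (rule span_scale)
      then show ?thesis
        using t by simp
    qed
  qed
  then have "dim {v \<in> UNIV. \<forall>w\<in>span C. orthogonal w v} \<le> dim L"
    by (rule dim_subset)
  moreover have "dim {v \<in> UNIV. \<forall>w\<in>span C. orthogonal w v} + dim C = CARD('n)"
    using dim_subspace_orthogonal_to_vectors[of "span C" UNIV] by (simp add: dim_span)
  ultimately show ?thesis
    using upper dimC dimL unfolding C_def by linarith
qed

subsection \<open>The enumerator\<close>

lemma order_invariant_braid_cone: "order_invariant (braid_cone Fs)"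
  unfolding order_invariant_def
proof (intro ballI allI impI)
  fix x y :: "real ^ 'a"
  assume x: "x \<in> braid_cone Fs" and xy: "order_equiv (($) x) (($) y)"
  have le: "x $ p \<le> x $ q \<longleftrightarrow> y $ p \<le> y $ q" for p q
    using xy unfolding order_equiv_def by blast
  show "y \<in> braid_cone Fs"
    using x unfolding braid_cone_def by (simp only: mem_Collect_eq le order_equiv_eq[OF xy])
qed

text \<open>The condition on the normal fan enters here: the cone is a union of braid cones, and
  invariance passes to unions.\<close>

lemma order_invariant_normal_cone:
  fixes P :: "(real ^ 'n::finite) set"
  assumes "extended_generalized_permutohedron P" "G \<in> nonempty_faces P"
  shows "order_invariant (normal_cone P G)"
proof -
  obtain S where S: "S \<subseteq> braid_fan" "coarsening (normal_fan P) S"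
    using assms unfolding extended_generalized_permutohedron_def subfan_def by blast
  have "normal_cone P G \<in> normal_fan P"
    using assms(2) by (simp add: normal_fan_def)
  then obtain T where T: "T \<subseteq> S" "normal_cone P G = \<Union>T"
    using S(2)[unfolded coarsening_def, rule_format] by metis
  have inv: "order_invariant C" if "C \<in> T" for C
  proof -
    have "C \<in> braid_fan"
      using that T(1) S(1) by (meson subsetD)
    then show ?thesis
      by (auto simp: braid_fan_def order_invariant_braid_cone)
  qed
  show ?thesis
    unfolding T(2) order_invariant_def
  proof (intro ballI allI impI)
    fix x y :: "real ^ 'n"
    assume "x \<in> \<Union>T" and xy: "order_equiv (($) x) (($) y)"
    then obtain C where "C \<in> T" "x \<in> C"
      by (meson UnionE)
    then show "y \<in> \<Union>T"
      using order_invariantD[OF inv xy] by (meson UnionI)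
  qed
qed

lemma convex_normal_cone: "convex (normal_cone P G)"
proof -
  have "(y - x) \<bullet> w \<le> 0 \<longleftrightarrow> w \<bullet> y \<le> w \<bullet> x" for w x y :: "real ^ 'a"
    by (simp add: inner_diff_left inner_commute[of w])
  then have "normal_cone P G = (\<Inter>x\<in>G. \<Inter>y\<in>P. {w. (y - x) \<bullet> w \<le> 0})"
    by (auto simp: normal_cone_def)
  then show ?thesis
    by (auto intro!: convex_INT convex_halfspace_le)
qed

section \<open>Sums over faces: the f-polynomial and the specialized enumerator\<close>

lemma finite_nonempty_faces: "polyhedron P \<Longrightarrow> finite (nonempty_faces P)"
  unfolding nonempty_faces_def using finite_polyhedron_faces by (rule rev_finite_subset) auto

text \<open>Grouping the faces by dimension. The bound on \<open>aff_dim P\<close> ensures that the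
  range \<open>i < n\<close> of the f-polynomial reaches every face.\<close>

lemma f_polynomial_eq_sum:
  fixes P :: "(real ^ 'n::finite) set"
  assumes "polyhedron P" "aff_dim P < int CARD('n)"
  shows "f_polynomial P = (\<Sum>G\<in>nonempty_faces P. monom 1 (nat (aff_dim G)))"
proof -
  have dim: "0 \<le> aff_dim G" "aff_dim G < int CARD('n)" if "G \<in> nonempty_faces P" for G
  proof -
    have "G \<noteq> {}" "G \<subseteq> P"
      using that by (auto simp: nonempty_faces_def face_of_imp_subset)
    then show "0 \<le> aff_dim G" "aff_dim G < int CARD('n)"
      using assms(2) aff_dim_subset[of G P] aff_dim_negative_iff[of G] by linarith+
  qed
  have "monom (int (f_number P i)) i =
      (\<Sum>G\<in>{G \<in> nonempty_faces P. nat (aff_dim G) = i}. monom 1 (nat (aff_dim G)))" for i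
  proof -
    \<comment> \<open>Nonempty faces have nonnegative dimension, so \<open>nat\<close> identifies no
      two of their dimensions.\<close>
    have "{G \<in> nonempty_faces P. aff_dim G = int i} = {G \<in> nonempty_faces P. nat (aff_dim G) = i}"
      using dim(1) by fastforce
    then show ?thesis
      by (simp add: f_number_def of_nat_poly smult_monom)
  qed
  then have "f_polynomial P =
      (\<Sum>i<CARD('n). \<Sum>G\<in>{G \<in> nonempty_faces P. nat (aff_dim G) = i}. monom 1 (nat (aff_dim G)))"
    unfolding f_polynomial_def by simp
  also have "\<dots> = (\<Sum>G\<in>nonempty_faces P. monom 1 (nat (aff_dim G)))"
  proof (rule sum.group[OF finite_nonempty_faces[OF assms(1)]])
    show "(\<lambda>G. nat (aff_dim G)) ` nonempty_faces P \<subseteq> {..<CARD('n)}"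
      using dim by fastforce
  qed simp
  finally show ?thesis .
qed

lemma negate_q_enumerator:
  "negate_q (enumerator P) M =
    (\<Sum>G\<in>nonempty_faces P. monom ((- 1) ^ nat (aff_dim G) *
      int (card {w. (\<forall>i. 1 \<le> w i) \<and> (\<chi> i. real (w i)) \<in> rel_interior (normal_cone P G) \<and>
        image_mset w (mset_set UNIV) = M})) (nat (aff_dim G)))"
proof -
  have "pcompose (monom a d) [:0, - 1:] = monom ((- 1) ^ d * a) d" for a :: int and d
    by (induction d) (simp_all add: monom_Suc monom_0 pcompose_pCons minus_monom)
  then show ?thesis
    unfolding negate_q_def enumerator_def
    by (simp add: pcompose_sum pcompose_mult of_nat_poly pcompose_const smult_monom)
qed

text \<open>Exchanging the sums over monomials and faces leaves, for each face, a count of words in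
  {1..m} sorted by their monomial; every word is counted once.\<close>

lemma ps1_negate_q_enumerator:
  fixes P :: "(real ^ 'n::finite) set"
  shows "ps1 (negate_q (enumerator P)) m =
    (\<Sum>G\<in>nonempty_faces P. monom ((- 1) ^ nat (aff_dim G) *
      int (card (box_points (rel_interior (normal_cone P G)) m))) (nat (aff_dim G)))"
proof -
  define g :: "('n \<Rightarrow> nat) \<Rightarrow> nat multiset" where "g w = image_mset w (mset_set UNIV)" for w
  define W where "W G M = {w. (\<forall>i. 1 \<le> w i) \<and>
      (\<chi> i. real (w i)) \<in> rel_interior (normal_cone P G) \<and> g w = M}" for G M
  define B where "B G = box_points (rel_interior (normal_cone P G)) m" for G
  \<comment> \<open>The finitely many monomials of words in {1..m}. Summing over \<open>D\<close>
    instead of the support only adds vanishing coefficients.\<close>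
  define D where "D = g ` {w. range w \<subseteq> {1..m}}"
  have F: "negate_q (enumerator P) M = (\<Sum>G\<in>nonempty_faces P.
      monom ((- 1) ^ nat (aff_dim G) * int (card (W G M))) (nat (aff_dim G)))" for M
    unfolding negate_q_enumerator W_def g_def ..
  have set_g: "set_mset (g w) = range w" for w
    by (simp add: g_def)
  have "{w :: 'n \<Rightarrow> nat. range w \<subseteq> {1..m}} = PiE UNIV (\<lambda>_. {1..m})"
    by auto
  then have "finite D"
    unfolding D_def by (simp add: finite_PiE)
  \<comment> \<open>The letters of a word are the variables of its monomial, so for \<open>M\<close>
    in the first \<open>m\<close> variables the upper bound on the letters is automatic.\<close>
  have W: "W G M = {w \<in> B G. g w = M}" if "set_mset M \<subseteq> {1..m}" for G M
  proof -
    have "(\<forall>i. 1 \<le> w i) \<longleftrightarrow> range w \<subseteq> {1..m}" if "g w = M" for w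
      using set_g[of w] that \<open>set_mset M \<subseteq> {1..m}\<close> by force
    then show ?thesis
      unfolding W_def B_def box_points_def by blast
  qed
  have D: "set_mset M \<subseteq> {1..m}" if "M \<in> D" for M
    using that set_g unfolding D_def by blast
  have "{M. negate_q (enumerator P) M \<noteq> 0 \<and> set_mset M \<subseteq> {1..m}} \<subseteq> D"
  proof clarify
    fix M assume nz: "negate_q (enumerator P) M \<noteq> 0" and M: "set_mset M \<subseteq> {1..m}"
    obtain G where "W G M \<noteq> {}"
    proof (rule ccontr)
      assume "\<not> thesis"
      then have "W G M = {}" for G
        using that by blast
      then show False
        using nz unfolding F by simp
    qed
    then obtain w where "w \<in> B G" "g w = M"
      unfolding W[OF M] by blast
    then show "M \<in> D"
      unfolding D_def B_def box_points_def by blast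
  qed
  then have "ps1 (negate_q (enumerator P)) m = (\<Sum>M\<in>D. negate_q (enumerator P) M)"
    unfolding ps1_def using \<open>finite D\<close> D by (intro sum.mono_neutral_left) auto
  also have "\<dots> = (\<Sum>G\<in>nonempty_faces P. \<Sum>M\<in>D.
      monom ((- 1) ^ nat (aff_dim G) * int (card (W G M))) (nat (aff_dim G)))"
    unfolding F by (rule sum.swap)
  also have "\<dots> = (\<Sum>G\<in>nonempty_faces P.
      monom ((- 1) ^ nat (aff_dim G) * int (card (B G))) (nat (aff_dim G)))"
  proof (rule sum.cong[OF refl])
    fix G
    have "(\<Sum>M\<in>D. \<Sum>w\<in>{w \<in> B G. g w = M}. 1 :: int) = (\<Sum>w\<in>B G. 1)"
    proof (rule sum.group)
      show "g ` B G \<subseteq> D"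
        unfolding D_def B_def box_points_def by blast
    qed (use \<open>finite D\<close> in \<open>simp_all add: B_def\<close>)
    moreover have "card (W G M) = card {w \<in> B G. g w = M}" if "M \<in> D" for M
      using W[OF D[OF that]] by simp
    ultimately have "(\<Sum>M\<in>D. int (card (W G M))) = int (card (B G))"
      by simp
    then show "(\<Sum>M\<in>D. monom ((- 1) ^ nat (aff_dim G) * int (card (W G M))) (nat (aff_dim G))) =
        monom ((- 1) ^ nat (aff_dim G) * int (card (B G))) (nat (aff_dim G))"
      by (simp add: sum_distrib_left[symmetric] monom_sum[symmetric])
  qed
  finally show ?thesis
    unfolding B_def .
qed

text \<open>This resolves the definite description: two polynomials over the domain of rational
  polynomials in q that agree at all natural numbers have infinitely many common values, so they
  coincide.\<close>

lemma ps1_poly_eqI: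
  assumes "\<And>m. poly p (of_nat m) = map_poly of_int (ps1 F m)"
  shows "ps1_poly F = p"
  unfolding ps1_poly_def
proof (rule the_equality)
  fix q :: "rat poly poly"
  assume q: "\<forall>m. poly q (of_nat m) = map_poly of_int (ps1 F m)"
  then have "range of_nat \<subseteq> {x. poly (q - p) x = 0}"
    using assms by auto
  moreover have "infinite (range (of_nat :: nat \<Rightarrow> rat poly))"
    by (simp add: finite_image_iff inj_of_nat)
  ultimately show "q = p"
    using poly_roots_finite[of "q - p"] finite_subset by auto
qed (use assms in blast)

theorem proposition3p5:
  fixes P :: "(real ^ 'n::finite) set"
  assumes "extended_generalized_permutohedron P"
    and "aff_dim P = int CARD('n) - 1"
  shows "map_poly of_int (f_polynomial P) =
    (-1) ^ CARD('n) * poly (ps1_poly (negate_q (enumerator P))) (-1)"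
proof -
  let ?U = "\<lambda>G. rel_interior (normal_cone P G)" and ?d = "\<lambda>G. nat (aff_dim G)"
  have "polyhedron P"
    using assms(1) by (simp add: extended_generalized_permutohedron_def)
  have "\<exists>p :: rat poly. (\<forall>m. poly p (of_nat m) = of_nat (card (box_points (?U G) m))) \<and>
      poly p (- 1) = (- 1) ^ (CARD('n) + ?d G)" if G: "G \<in> nonempty_faces P" for G
  proof -
    have ne: "normal_cone P G \<noteq> {}"
      by (auto simp: normal_cone_def intro: exI[of _ 0])
    have "G \<noteq> {}" "G \<subseteq> P"
      using G by (auto simp: nonempty_faces_def face_of_imp_subset)
    then have "0 \<le> aff_dim G" "aff_dim G \<le> int CARD('n)"
      using assms(2) aff_dim_subset[of G P] aff_dim_negative_iff[of G] by linarith+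
    moreover have "aff_dim (?U G) = int CARD('n) - aff_dim G"
      using aff_dim_normal_cone[OF \<open>polyhedron P\<close> G]
      by (simp add: rel_interior_aff_dim convex_normal_cone)
    \<comment> \<open>With \<open>d\<close> the dimension of the face, n + d and the dimension n - d
      of the cone differ by the even number 2d, so the signs agree.\<close>
    ultimately have "CARD('n) + ?d G = nat (aff_dim (?U G)) + 2 * ?d G"
      by simp
    then have "(- 1 :: rat) ^ (CARD('n) + ?d G) = (- 1) ^ nat (aff_dim (?U G))"
      by (simp add: power_add)
    moreover have "\<exists>p :: rat poly. (\<forall>m. poly p (of_nat m) = of_nat (card (box_points (?U G) m))) \<and>
        poly p (- 1) = (- 1) ^ nat (aff_dim (?U G))"
      using ne order_invariant_normal_cone[OF assms(1) G]
      by (intro box_points_poly)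
        (simp_all add: convex_normal_cone convex_rel_interior rel_interior_rel_open
          rel_interior_eq_empty order_invariant_rel_interior)
    ultimately show ?thesis
      by simp
  qed
  then obtain p :: "(real ^ 'n) set \<Rightarrow> rat poly" where
    p: "\<And>G m. G \<in> nonempty_faces P \<Longrightarrow> poly (p G) (of_nat m) = of_nat (card (box_points (?U G) m))"
      "\<And>G. G \<in> nonempty_faces P \<Longrightarrow> poly (p G) (- 1) = (- 1) ^ (CARD('n) + ?d G)"
    by metis
  \<comment> \<open>Each counting polynomial in m becomes a polynomial with coefficients constant in
    q, weighted by the power of -q belonging to the face.\<close>
  define Q :: "rat poly poly" where
    "Q = (\<Sum>G\<in>nonempty_faces P. smult (monom ((- 1) ^ ?d G) (?d G)) (map_poly (\<lambda>c. [:c:]) (p G)))"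
  have Q: "poly Q [:c:] = (\<Sum>G\<in>nonempty_faces P. monom ((- 1) ^ ?d G * poly (p G) c) (?d G))" for c
  proof -
    have "poly (map_poly (\<lambda>c. [:c:]) r) [:c:] = [:poly r c:]" for r :: "rat poly"
      by (induction r) (simp_all add: map_poly_pCons)
    then show ?thesis
      by (simp add: Q_def poly_sum smult_monom mult.commute)
  qed
  have "ps1_poly (negate_q (enumerator P)) = Q"
  proof (rule ps1_poly_eqI)
    fix m
    have "poly Q (of_nat m) = (\<Sum>G\<in>nonempty_faces P.
        monom ((- 1) ^ ?d G * of_nat (card (box_points (?U G) m))) (?d G))"
      unfolding of_nat_poly Q by (intro sum.cong refl) (simp add: p)
    also have "\<dots> = map_poly of_int (ps1 (negate_q (enumerator P)) m)"
      unfolding ps1_negate_q_enumerator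
      by (intro poly_eqI) (auto simp: coeff_map_poly coeff_sum of_int_sum intro!: sum.cong)
    finally show "poly Q (of_nat m) = map_poly of_int (ps1 (negate_q (enumerator P)) m)" .
  qed
  moreover have "poly Q (- 1) = (\<Sum>G\<in>nonempty_faces P. monom ((- 1) ^ CARD('n)) (?d G))"
  proof -
    \<comment> \<open>The evaluation point is the constant polynomial -1 in q, which brings the
      formula \<open>Q\<close> into play.\<close>
    have "- 1 = [:- 1 :: rat:]"
      by (simp add: one_pCons)
    then have "poly Q (- 1) =
        (\<Sum>G\<in>nonempty_faces P. monom ((- 1) ^ ?d G * poly (p G) (- 1)) (?d G))"
      using Q by metis
    also have "\<dots> = (\<Sum>G\<in>nonempty_faces P. monom ((- 1) ^ CARD('n)) (?d G))"
      \<comment> \<open>The sign (-1)^d from negating q cancels against the one inside (-1)^(n+d),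
        leaving a sign common to all faces.\<close>
      by (intro sum.cong refl) (simp add: p power_add)
    finally show ?thesis .
  qed
  moreover have "(- 1) ^ CARD('n) * monom ((- 1) ^ CARD('n)) d = (monom 1 d :: rat poly)" for d
    by (cases "even CARD('n)") (simp_all add: minus_monom)
  ultimately have "(- 1) ^ CARD('n) * poly (ps1_poly (negate_q (enumerator P))) (- 1) =
      (\<Sum>G\<in>nonempty_faces P. monom 1 (?d G))"
    by (simp add: sum_distrib_left)
  also have "\<dots> = map_poly of_int (f_polynomial P)"
    using f_polynomial_eq_sum[OF \<open>polyhedron P\<close>] assms(2)
    by (intro poly_eqI) (auto simp: coeff_map_poly coeff_sum of_int_sum intro!: sum.cong)
  finally show ?thesis
    by simp
qed

end
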